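(* (Logarithmic Euler–MacLaurin summation formula.) Let $p(x)$ be a discrete formal power series of logarithmic type, i.e. $p\in\mathcal I$, and let $n\ge0$ be an integer. Then the following identity (with convergent right-hand side) holds in $\mathcal I$: $$p(x)+p(x+1)+\cdots+p(x+n)=B_0\int_x^{x+n+1}p(t)\,dt+\sum_{k\ge1}\frac{B_k}{k!}\Big[p^{(k-1)}(x+n+1)-p^{(k-1)}(x)\Big].$$
   Context: $\mathcal I$ is the discrete iterated logarithmic algebra: the algebra of formal series with complex coefficients in the monomials $x^{a}(\log x)^{\alpha_1}(\log\log x)^{\alpha_2}\cdots$, with $a\in\mathbb Z$ and $(\alpha_1,\alpha_2,\dots)$ a finitely supported vector of integers, where monomials are ordered lexicographically (exponent of $x$ first, then $\alpha_1$, $\alpha_2$, ...) and the support of a series is reverse well-ordered. The derivative $D=d/dx$ acts termwise, using the usual rules for differentiating powers of $x$ and of iterated logarithms; $p^{(k)}=D^kp$. The shift is $p(x+m)=\sum_{k\ge0}\frac{m^k}{k!}D^kp(x)$. The integral $\int_x^{x+m}p(t)\,dt$ denotes $\sum_{k\ge1}\frac{m^k}{k!}D^{k-1}p(x)$ (equivalently $P(x+m)-P(x)$ for any antiderivative $P\in\mathcal I$ of $p$). Infinite sums are taken in $\mathcal I$ coefficientwise (each monomial receives finitely many nonzero contributions). The Bernoulli numbers are $B_k=B_k(0)$, where $B_k(x)=J^{-1}x^k$ are the Bernoulli polynomials and $J=(e^D-1)/D$; equivalently $\sum_{k\ge0}B_kt^k/k!=t/(e^t-1)$. *)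

theory Defs
  imports "HOL-Library.Poly_Mapping" "HOL-Computational_Algebra.Computational_Algebra"
begin

section \<open>Series of logarithmic type\<close>

text \<open>
  Writing \<open>\<ell>\<^sub>0 = x\<close>, \<open>\<ell>\<^sub>1 = log x\<close>, \<open>\<ell>\<^sub>2 = log log x\<close>, and so on, a monomial is represented by its
  finitely supported exponent vector: \<open>u\<close> stands for the product of all \<open>\<ell>\<^sub>i ^ u\<^sub>i\<close>, so index \<open>0\<close>
  carries the exponent of \<open>x\<close>.  The library's order on \<open>nat \<Rightarrow>\<^sub>0 int\<close> is the lexicographic one, with
  index \<open>0\<close> compared first (see \<open>lmonom_less_iff\<close>).
\<close>

type_synonym lmonom = "nat \<Rightarrow>\<^sub>0 int"

lemma lmonom_less_iff:
  "(u :: lmonom) < v \<longleftrightarrow>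
     (\<exists>i. Poly_Mapping.lookup u i < Poly_Mapping.lookup v i \<and>
          (\<forall>j<i. Poly_Mapping.lookup u j = Poly_Mapping.lookup v j))"
  by (simp add: less_poly_mapping.rep_eq less_fun_def)

definition rev_well_ordered :: "'a::linorder set \<Rightarrow> bool" where
  "rev_well_ordered A \<longleftrightarrow> wfp_on A (>)"

lemma rev_well_ordered_iff:
  "rev_well_ordered A \<longleftrightarrow> (\<forall>B\<subseteq>A. B \<noteq> {} \<longrightarrow> (\<exists>z\<in>B. \<forall>y\<in>B. y \<le> z))"
  unfolding rev_well_ordered_def wfp_on_iff_ex_minimal by (meson leD leI)

lemma rev_well_ordered_subset: "rev_well_ordered B \<Longrightarrow> A \<subseteq> B \<Longrightarrow> rev_well_ordered A"
  unfolding rev_well_ordered_iff by (meson order_trans)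

lemma rev_well_ordered_Un:
  assumes "rev_well_ordered A" "rev_well_ordered B"
  shows "rev_well_ordered (A \<union> B)"
  unfolding rev_well_ordered_iff
proof (intro allI impI)
  fix C assume C: "C \<subseteq> A \<union> B" "C \<noteq> {}"
  consider "C \<inter> A = {}" | "C \<inter> B = {}" | "C \<inter> A \<noteq> {}" "C \<inter> B \<noteq> {}" by blast
  then show "\<exists>z\<in>C. \<forall>y\<in>C. y \<le> z"
  proof cases
    case 1
    then have "C \<subseteq> B" using C by blast
    then show ?thesis using assms(2) C(2) unfolding rev_well_ordered_iff by blast
  next
    case 2
    then have "C \<subseteq> A" using C by blast
    then show ?thesis using assms(1) C(2) unfolding rev_well_ordered_iff by blast
  next
    case 3
    obtain z where z: "z \<in> C \<inter> A" "\<forall>y\<in>C \<inter> A. y \<le> z"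
      using assms(1) 3 unfolding rev_well_ordered_iff by (meson inf_le2)
    obtain w where w: "w \<in> C \<inter> B" "\<forall>y\<in>C \<inter> B. y \<le> w"
      using assms(2) 3 unfolding rev_well_ordered_iff by (meson inf_le2)
    have "\<forall>y\<in>C. y \<le> max z w" using z w C by (auto simp: le_max_iff_disj)
    moreover have "max z w \<in> C" using z w by (auto simp: max_def)
    ultimately show ?thesis by blast
  qed
qed

lemma rev_well_ordered_finite: "finite A \<Longrightarrow> rev_well_ordered A"
  unfolding rev_well_ordered_iff by (meson Max_ge Max_in finite_subset)

lemma rev_well_ordered_UN_finite:
  "finite I \<Longrightarrow> (\<And>i. i \<in> I \<Longrightarrow> rev_well_ordered (S i)) \<Longrightarrow> rev_well_ordered (\<Union>i\<in>I. S i)"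
  by (induction I rule: finite_induct) (auto intro: rev_well_ordered_Un rev_well_ordered_finite)

lemma rev_well_ordered_iff_seq:
  "rev_well_ordered A \<longleftrightarrow> (\<nexists>s :: nat \<Rightarrow> 'a::linorder. range s \<subseteq> A \<and> strict_mono s)"
proof
  assume A: "rev_well_ordered A"
  show "\<nexists>s :: nat \<Rightarrow> 'a. range s \<subseteq> A \<and> strict_mono s"
  proof
    assume "\<exists>s :: nat \<Rightarrow> 'a. range s \<subseteq> A \<and> strict_mono s"
    then obtain s :: "nat \<Rightarrow> 'a" where s: "range s \<subseteq> A" "strict_mono s" by blast
    obtain z where "z \<in> range s" "\<forall>y\<in>range s. y \<le> z"
      using A s(1) unfolding rev_well_ordered_iff by blast
    then obtain n where "\<forall>m. s m \<le> s n" by blast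
    then show False using s(2) by (meson leD lessI strict_mono_less)
  qed
next
  assume N: "\<nexists>s :: nat \<Rightarrow> 'a. range s \<subseteq> A \<and> strict_mono s"
  show "rev_well_ordered A"
  proof (rule ccontr)
    assume "\<not> rev_well_ordered A"
    then obtain B where B: "B \<subseteq> A" "B \<noteq> {}" "\<forall>z\<in>B. \<exists>y\<in>B. z < y"
      unfolding rev_well_ordered_iff by (meson not_le)
    then obtain b where b: "b \<in> B" by blast
    obtain g where g: "\<And>z. z \<in> B \<Longrightarrow> g z \<in> B \<and> z < g z" using B(3) by metis
    define s where "s n = (g ^^ n) b" for n
    have sB: "s n \<in> B" for n by (induction n) (auto simp: s_def b g)
    have "strict_mono s" unfolding strict_mono_Suc_iff using g sB by (simp add: s_def)
    then show False using N sB B(1) by blast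
  qed
qed

lemma rev_well_ordered_decseq_subseq:
  fixes s :: "nat \<Rightarrow> 'a::linorder"
  assumes "rev_well_ordered A" "range s \<subseteq> A"
  shows "\<exists>r. strict_mono (r :: nat \<Rightarrow> nat) \<and> decseq (s \<circ> r)"
proof -
  obtain f where f: "strict_mono (f :: nat \<Rightarrow> nat)" "monoseq (\<lambda>n. s (f n))"
    using seq_monosub[of s] by blast
  show ?thesis
  proof (cases "decseq (s \<circ> f)")
    case True then show ?thesis using f by blast
  next
    case False
    then have inc: "incseq (s \<circ> f)" using f(2) by (auto simp: monoseq_iff comp_def)
    obtain N where N: "\<forall>m. s (f m) \<le> s (f N)"
    proof -
      have "range (s \<circ> f) \<subseteq> A" using assms(2) by auto
      then obtain z where "z \<in> range (s \<circ> f)" "\<forall>y\<in>range (s \<circ> f). y \<le> z"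
        using assms(1) unfolding rev_well_ordered_iff by blast
      then show ?thesis using that by auto
    qed
    have const: "s (f (n + N)) = s (f N)" for n
      using N incseqD[OF inc, of N "n + N"] by (simp add: antisym)
    have "decseq (s \<circ> (\<lambda>n. f (n + N)))" by (simp add: decseq_def const)
    moreover have "strict_mono (\<lambda>n. f (n + N))"
      using f(1) by (simp add: strict_mono_def)
    ultimately show ?thesis by blast
  qed
qed

lemma rev_well_ordered_add:
  fixes A B :: "'a::linordered_ab_group_add set"
  assumes "rev_well_ordered A" "rev_well_ordered B"
  shows "rev_well_ordered {a + b | a b. a \<in> A \<and> b \<in> B}"
  unfolding rev_well_ordered_iff_seq
proof
  assume "\<exists>s :: nat \<Rightarrow> 'a. range s \<subseteq> {a + b | a b. a \<in> A \<and> b \<in> B} \<and> strict_mono s"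
  then obtain s :: "nat \<Rightarrow> 'a" where s: "range s \<subseteq> {a + b | a b. a \<in> A \<and> b \<in> B}" "strict_mono s"
    by blast
  then have "\<forall>n. \<exists>a b. s n = a + b \<and> a \<in> A \<and> b \<in> B" by blast
  then obtain a b where ab: "\<And>n. s n = a n + b n" "\<And>n. a n \<in> A" "\<And>n. b n \<in> B" by metis
  obtain r where r: "strict_mono (r :: nat \<Rightarrow> nat)" "decseq (a \<circ> r)"
    using rev_well_ordered_decseq_subseq[OF assms(1), of a] ab by blast
  have "strict_mono (b \<circ> r)"
  proof (rule strict_monoI)
    fix m n :: nat assume mn: "m < n"
    have "s (r m) < s (r n)" using s(2) r(1) mn by (simp add: strict_mono_def)
    moreover have "a (r n) \<le> a (r m)" using r(2) mn by (simp add: decseq_def)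
    ultimately show "(b \<circ> r) m < (b \<circ> r) n"
      using ab(1) by (metis add_mono comp_apply leD leI)
  qed
  moreover have "range (b \<circ> r) \<subseteq> B" using ab by auto
  ultimately show False using assms(2) unfolding rev_well_ordered_iff_seq by blast
qed

lemma rev_well_ordered_finite_decomp:
  fixes A B :: "'a::linordered_ab_group_add set"
  assumes "rev_well_ordered A" "rev_well_ordered B"
  shows "finite {a \<in> A. c - a \<in> B}" (is "finite ?S")
proof (rule ccontr)
  assume inf: "infinite ?S"
  then obtain s :: "nat \<Rightarrow> 'a" where s: "inj s" "range s \<subseteq> ?S"
    by (meson infinite_countable_subset)
  obtain r where r: "strict_mono (r :: nat \<Rightarrow> nat)" "decseq (s \<circ> r)"
    using rev_well_ordered_decseq_subseq[OF assms(1), of s] s by blast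
  have "strict_mono (\<lambda>n. c - s (r n))"
  proof (rule strict_monoI)
    fix m n :: nat assume mn: "m < n"
    have "s (r n) \<le> s (r m)" using r(2) mn by (simp add: decseq_def)
    moreover have "s (r n) \<noteq> s (r m)" using s(1) r(1) mn
      by (metis injD less_irrefl strict_mono_less)
    ultimately show "c - s (r m) < c - s (r n)" by simp
  qed
  moreover have "range (\<lambda>n. c - s (r n)) \<subseteq> B" using s by auto
  ultimately show False using assms(2) unfolding rev_well_ordered_iff_seq by blast
qed

typedef ilog = "{f :: lmonom \<Rightarrow> complex. rev_well_ordered {u. f u \<noteq> 0}}"
  morphisms lcoeff Abs_ilog
  by (rule exI[of _ "\<lambda>_. 0"]) (simp add: rev_well_ordered_iff)

setup_lifting type_definition_ilog

lemma rev_well_ordered_support: "rev_well_ordered {u. lcoeff p u \<noteq> 0}"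
  using lcoeff[of p] by simp

lemma ilog_eqI: "(\<And>u. lcoeff p u = lcoeff q u) \<Longrightarrow> p = q"
  by (simp add: lcoeff_inject[symmetric] fun_eq_iff)

instantiation ilog :: ab_group_add
begin

lift_definition zero_ilog :: ilog is "\<lambda>_. 0"
  by (simp add: rev_well_ordered_finite)

lift_definition plus_ilog :: "ilog \<Rightarrow> ilog \<Rightarrow> ilog" is "\<lambda>f g u. f u + g u"
  by (rule rev_well_ordered_subset, rule rev_well_ordered_Un, assumption, assumption) auto

lift_definition minus_ilog :: "ilog \<Rightarrow> ilog \<Rightarrow> ilog" is "\<lambda>f g u. f u - g u"
  by (rule rev_well_ordered_subset, rule rev_well_ordered_Un, assumption, assumption) auto

lift_definition uminus_ilog :: "ilog \<Rightarrow> ilog" is "\<lambda>f u. - f u"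
  by simp

instance
  by standard (transfer, simp add: fun_eq_iff)+

end

lift_definition lscale :: "complex \<Rightarrow> ilog \<Rightarrow> ilog" (infixr \<open>*\<^sub>L\<close> 75) is "\<lambda>c f u. c * f u"
  by (erule rev_well_ordered_subset) auto

text \<open>The monomial with exponent vector \<open>u\<close>, as a series.\<close>

definition lmon :: "lmonom \<Rightarrow> ilog" where
  "lmon u = Abs_ilog (\<lambda>v. if v = u then 1 else 0)"

lemma lcoeff_lmon: "lcoeff (lmon u) v = (if v = u then 1 else 0)"
  by (simp add: lmon_def Abs_ilog_inverse rev_well_ordered_finite)

lemmas lcoeff_simps [simp] =
  zero_ilog.rep_eq plus_ilog.rep_eq minus_ilog.rep_eq uminus_ilog.rep_eq lscale.rep_eq lcoeff_lmon

lemma lcoeff_sum [simp]: "lcoeff (sum f A) u = (\<Sum>i\<in>A. lcoeff (f i) u)"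
  by (induction A rule: infinite_finite_induct) auto

lemma vector_space_lscale: "vector_space lscale"
  by standard (rule ilog_eqI, simp add: algebra_simps)+


section \<open>Infinite sums\<close>

definition has_ilog_sum :: "('i \<Rightarrow> ilog) \<Rightarrow> 'i set \<Rightarrow> ilog \<Rightarrow> bool" where
  "has_ilog_sum f A s \<longleftrightarrow>
     (\<forall>u. finite {i\<in>A. lcoeff (f i) u \<noteq> 0} \<and>
          lcoeff s u = (\<Sum>i | i \<in> A \<and> lcoeff (f i) u \<noteq> 0. lcoeff (f i) u))"

definition ilog_summable :: "('i \<Rightarrow> ilog) \<Rightarrow> 'i set \<Rightarrow> bool" where
  "ilog_summable f A \<longleftrightarrow> (\<exists>s. has_ilog_sum f A s)"

definition ilog_sum :: "('i \<Rightarrow> ilog) \<Rightarrow> 'i set \<Rightarrow> ilog" where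
  "ilog_sum f A = (THE s. has_ilog_sum f A s)"

lemma has_ilog_sum_unique: "has_ilog_sum f A s \<Longrightarrow> has_ilog_sum f A t \<Longrightarrow> s = t"
  by (rule ilog_eqI) (simp add: has_ilog_sum_def)

lemma ilog_sum_eqI: "has_ilog_sum f A s \<Longrightarrow> ilog_sum f A = s"
  unfolding ilog_sum_def by (rule the_equality) (auto dest: has_ilog_sum_unique)

lemma has_ilog_sum_ilog_sum: "ilog_summable f A \<Longrightarrow> has_ilog_sum f A (ilog_sum f A)"
  unfolding ilog_summable_def using ilog_sum_eqI by metis

lemma ilog_summableI:
  assumes fin: "\<And>u. finite {i\<in>A. lcoeff (f i) u \<noteq> 0}"
    and supp: "rev_well_ordered (\<Union>i\<in>A. {u. lcoeff (f i) u \<noteq> 0})"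
  shows "ilog_summable f A"
proof -
  define g where "g u = (\<Sum>i | i \<in> A \<and> lcoeff (f i) u \<noteq> 0. lcoeff (f i) u)" for u
  have "rev_well_ordered {u. g u \<noteq> 0}"
  proof (rule rev_well_ordered_subset[OF supp], safe)
    fix u assume "g u \<noteq> 0"
    then obtain i where "i \<in> A" "lcoeff (f i) u \<noteq> 0"
      unfolding g_def by (metis (mono_tags, lifting) mem_Collect_eq sum.neutral)
    then show "u \<in> (\<Union>i\<in>A. {u. lcoeff (f i) u \<noteq> 0})" by blast
  qed
  then have "has_ilog_sum f A (Abs_ilog g)"
    using fin by (simp add: has_ilog_sum_def Abs_ilog_inverse g_def)
  then show ?thesis unfolding ilog_summable_def by blast
qed


section \<open>The derivative\<close>

text \<open>
  \<open>log_prod j\<close> is the monomial \<open>\<ell>\<^sub>0 \<ell>\<^sub>1 \<dots> \<ell>\<^sub>j\<close>.  Since \<open>\<ell>\<^sub>j\<close> has derivative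
  \<open>1 / (\<ell>\<^sub>0 \<ell>\<^sub>1 \<dots> \<ell>\<^sub>j\<^sub>-\<^sub>1)\<close>, the factor \<open>\<ell>\<^sub>j ^ a\<close> has logarithmic derivative \<open>a / log_prod j\<close>.
\<close>

definition log_prod :: "nat \<Rightarrow> lmonom" where
  "log_prod j = (\<Sum>i\<le>j. Poly_Mapping.single i 1)"

definition lderiv_monom :: "lmonom \<Rightarrow> ilog" where
  "lderiv_monom u = (\<Sum>j\<in>Poly_Mapping.keys u.
      of_int (Poly_Mapping.lookup u j) *\<^sub>L lmon (u - log_prod j))"

definition lderiv :: "ilog \<Rightarrow> ilog" where
  "lderiv p = ilog_sum (\<lambda>u. lcoeff p u *\<^sub>L lderiv_monom u) UNIV"

lemma lookup_log_prod: "Poly_Mapping.lookup (log_prod j) i = (if i \<le> j then 1 else 0)"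
proof -
  have "Poly_Mapping.lookup (log_prod j) i = (\<Sum>k\<le>j. if k = i then 1 else 0)"
    by (simp add: log_prod_def lookup_sum lookup_single when_def)
  then show ?thesis by simp
qed

lemma rev_well_ordered_log_prod: "rev_well_ordered (range (\<lambda>j. - log_prod j))"
proof -
  have mono: "log_prod i \<le> log_prod j" if "i \<le> j" for i j
  proof (cases "i = j")
    case False
    then have "log_prod i < log_prod j"
      unfolding lmonom_less_iff using that by (intro exI[of _ "Suc i"]) (auto simp: lookup_log_prod)
    then show ?thesis by simp
  qed simp
  show ?thesis unfolding rev_well_ordered_iff
  proof (intro allI impI)
    fix B assume B: "B \<subseteq> range (\<lambda>j. - log_prod j)" "B \<noteq> {}"
    define k where "k = (LEAST j. - log_prod j \<in> B)"
    have "\<exists>j. - log_prod j \<in> B" using B by auto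
    then have "- log_prod k \<in> B" unfolding k_def by (rule LeastI_ex)
    moreover have "y \<le> - log_prod k" if "y \<in> B" for y
    proof -
      obtain j where j: "y = - log_prod j" using B(1) \<open>y \<in> B\<close> by blast
      then have "k \<le> j" unfolding k_def using \<open>y \<in> B\<close> by (auto intro: Least_le)
      then show ?thesis using j mono by simp
    qed
    ultimately show "\<exists>z\<in>B. \<forall>y\<in>B. y \<le> z" by blast
  qed
qed

lemma lcoeff_lderiv_monom_nonzero:
  assumes "lcoeff (lderiv_monom u) v \<noteq> 0"
  obtains j where "v - u = - log_prod j"
proof -
  obtain j where "lcoeff (of_int (Poly_Mapping.lookup u j) *\<^sub>L lmon (u - log_prod j)) v \<noteq> 0"
    using assms unfolding lderiv_monom_def lcoeff_sum by (meson sum.neutral)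
  then have "v = u - log_prod j" by (auto split: if_splits)
  then show ?thesis using that[of j] by simp
qed

lemma lderiv_summable: "ilog_summable (\<lambda>u. lcoeff p u *\<^sub>L lderiv_monom u) UNIV"
proof (rule ilog_summableI)
  fix v
  have "{u. lcoeff (lcoeff p u *\<^sub>L lderiv_monom u) v \<noteq> 0} \<subseteq>
        {u \<in> {u. lcoeff p u \<noteq> 0}. v - u \<in> range (\<lambda>j. - log_prod j)}"
    by (auto elim: lcoeff_lderiv_monom_nonzero)
  then show "finite {u \<in> UNIV. lcoeff (lcoeff p u *\<^sub>L lderiv_monom u) v \<noteq> 0}"
    using rev_well_ordered_finite_decomp[OF rev_well_ordered_support rev_well_ordered_log_prod]
    by (simp add: finite_subset)
next
  show "rev_well_ordered (\<Union>u\<in>UNIV. {v. lcoeff (lcoeff p u *\<^sub>L lderiv_monom u) v \<noteq> 0})"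
  proof (rule rev_well_ordered_subset[OF rev_well_ordered_add[OF rev_well_ordered_support[of p]
        rev_well_ordered_log_prod]], safe)
    fix u v assume nz: "lcoeff (lcoeff p u *\<^sub>L lderiv_monom u) v \<noteq> 0"
    then obtain j where "v - u = - log_prod j" by (auto elim: lcoeff_lderiv_monom_nonzero)
    then have "v = u + (- log_prod j)" by (simp add: algebra_simps)
    then show "\<exists>a b. v = a + b \<and> a \<in> {u. lcoeff p u \<noteq> 0} \<and> b \<in> range (\<lambda>j. - log_prod j)"
      using nz by (intro exI[of _ u] exI[of _ "- log_prod j"]) auto
  qed
qed

lemma has_ilog_sum_lderiv: "has_ilog_sum (\<lambda>u. lcoeff p u *\<^sub>L lderiv_monom u) UNIV (lderiv p)"
  unfolding lderiv_def using lderiv_summable by (rule has_ilog_sum_ilog_sum)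

lemma lderiv_lmon: "lderiv (lmon u) = lderiv_monom u"
proof -
  have *: "{w. lcoeff (lcoeff (lmon u) w *\<^sub>L lderiv_monom w) v \<noteq> 0} =
      (if lcoeff (lderiv_monom u) v = 0 then {} else {u})" for v
    by auto
  have "has_ilog_sum (\<lambda>w. lcoeff (lmon u) w *\<^sub>L lderiv_monom w) UNIV (lderiv_monom u)"
    unfolding has_ilog_sum_def using * by simp
  then show ?thesis unfolding lderiv_def by (rule ilog_sum_eqI)
qed


section \<open>Series in the derivative, shifts and integrals\<close>

definition xdeg_le :: "ilog \<Rightarrow> int \<Rightarrow> bool" where
  "xdeg_le p N \<longleftrightarrow> (\<forall>u. lcoeff p u \<noteq> 0 \<longrightarrow> Poly_Mapping.lookup u 0 \<le> N)"

lemma lmonom_le_imp_lookup_0_le: "(u :: lmonom) \<le> v \<Longrightarrow> Poly_Mapping.lookup u 0 \<le> Poly_Mapping.lookup v 0"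
  unfolding le_less lmonom_less_iff by (metis gr0I order_le_less)

lemma xdeg_le_exists: "\<exists>N. xdeg_le p N"
proof (cases "{u. lcoeff p u \<noteq> 0} = {}")
  case True then show ?thesis by (auto simp: xdeg_le_def)
next
  case False
  then obtain z where "\<forall>y\<in>{u. lcoeff p u \<noteq> 0}. y \<le> z"
    using rev_well_ordered_support[of p] unfolding rev_well_ordered_iff by blast
  then show ?thesis unfolding xdeg_le_def using lmonom_le_imp_lookup_0_le by blast
qed

lemma xdeg_le_lderiv: "xdeg_le p N \<Longrightarrow> xdeg_le (lderiv p) (N - 1)"
  unfolding xdeg_le_def
proof (intro allI impI)
  fix v assume p: "\<forall>u. lcoeff p u \<noteq> 0 \<longrightarrow> Poly_Mapping.lookup u 0 \<le> N" and v: "lcoeff (lderiv p) v \<noteq> 0"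
  obtain u where u: "lcoeff (lcoeff p u *\<^sub>L lderiv_monom u) v \<noteq> 0"
  proof -
    have "(\<Sum>u | u \<in> UNIV \<and> lcoeff (lcoeff p u *\<^sub>L lderiv_monom u) v \<noteq> 0.
             lcoeff (lcoeff p u *\<^sub>L lderiv_monom u) v) \<noteq> 0"
      using v has_ilog_sum_lderiv[of p] unfolding has_ilog_sum_def by metis
    then show ?thesis using that by (metis (mono_tags, lifting) mem_Collect_eq sum.neutral)
  qed
  then obtain j where j: "v - u = - log_prod j" by (auto elim: lcoeff_lderiv_monom_nonzero)
  have "Poly_Mapping.lookup (v - u) 0 = -1" unfolding j by (simp add: lookup_log_prod)
  then have "Poly_Mapping.lookup v 0 = Poly_Mapping.lookup u 0 - 1" by (simp add: lookup_minus)
  then show "Poly_Mapping.lookup v 0 \<le> N - 1" using p u by auto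
qed

lemma xdeg_le_funpow_lderiv: "xdeg_le p N \<Longrightarrow> xdeg_le ((lderiv ^^ k) p) (N - int k)"
proof (induction k)
  case (Suc k)
  then show ?case using xdeg_le_lderiv[of "(lderiv ^^ k) p" "N - int k"]
    by (simp add: algebra_simps)
qed simp

lemma ilog_summable_decreasing_xdeg:
  fixes f :: "nat \<Rightarrow> ilog"
  assumes f: "\<And>k. k \<in> A \<Longrightarrow> xdeg_le (f k) (N - int k)"
  shows "ilog_summable f A"
proof (rule ilog_summableI)
  fix u
  have "{k \<in> A. lcoeff (f k) u \<noteq> 0} \<subseteq> {..nat (N - Poly_Mapping.lookup u 0)}"
    using f unfolding xdeg_le_def by fastforce
  then show "finite {k \<in> A. lcoeff (f k) u \<noteq> 0}" by (rule finite_subset) simp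
next
  show "rev_well_ordered (\<Union>k\<in>A. {u. lcoeff (f k) u \<noteq> 0})"
    unfolding rev_well_ordered_iff
  proof (intro allI impI)
    fix T assume T: "T \<subseteq> (\<Union>k\<in>A. {u. lcoeff (f k) u \<noteq> 0})" "T \<noteq> {}"
    then obtain t where t: "t \<in> T" by blast
    define K where "K = nat (N - Poly_Mapping.lookup t 0)"
    define T' where "T' = {u\<in>T. Poly_Mapping.lookup t 0 \<le> Poly_Mapping.lookup u 0}"
    have "T' \<subseteq> (\<Union>k\<in>{..K}. {u. lcoeff (f k) u \<noteq> 0})"
    proof
      fix u assume u: "u \<in> T'"
      then obtain k where k: "k \<in> A" "lcoeff (f k) u \<noteq> 0" using T unfolding T'_def by blast
      then have "Poly_Mapping.lookup u 0 \<le> N - int k" using f unfolding xdeg_le_def by blast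
      then have "k \<le> K" using u unfolding K_def T'_def by auto
      then show "u \<in> (\<Union>k\<in>{..K}. {u. lcoeff (f k) u \<noteq> 0})" using k by blast
    qed
    moreover have "rev_well_ordered (\<Union>k\<in>{..K}. {u. lcoeff (f k) u \<noteq> 0})"
      by (rule rev_well_ordered_UN_finite) (auto intro: rev_well_ordered_support)
    moreover have tT': "t \<in> T'" using t unfolding T'_def by simp
    ultimately obtain z where z: "z \<in> T'" "\<forall>y\<in>T'. y \<le> z"
      unfolding rev_well_ordered_iff by (metis empty_iff)
    have "y \<le> z" if y: "y \<in> T" for y
    proof (cases "y \<in> T'")
      case False
      then have "Poly_Mapping.lookup y 0 < Poly_Mapping.lookup t 0" using y unfolding T'_def by auto
      then have "y < t" unfolding lmonom_less_iff by (intro exI[of _ 0]) simp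
      then show ?thesis using z tT' by (meson less_le_trans less_imp_le)
    qed (use z in blast)
    then show "\<exists>z\<in>T. \<forall>y\<in>T. y \<le> z" using z unfolding T'_def by blast
  qed
qed

lemma xdeg_le_lscale: "xdeg_le p N \<Longrightarrow> xdeg_le (c *\<^sub>L p) N"
  by (simp add: xdeg_le_def)

text \<open>The shifted series \<open>p(x + m)\<close>.\<close>

definition lshift :: "complex \<Rightarrow> ilog \<Rightarrow> ilog" where
  "lshift m p = ilog_sum (\<lambda>k. (m ^ k / fact k) *\<^sub>L (lderiv ^^ k) p) UNIV"

text \<open>The integral of \<open>p\<close> from \<open>x\<close> to \<open>x + m\<close>.\<close>

definition lintegral :: "complex \<Rightarrow> ilog \<Rightarrow> ilog" where
  "lintegral m p = ilog_sum (\<lambda>k. (m ^ k / fact k) *\<^sub>L (lderiv ^^ (k - 1)) p) {1..}"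

lemma has_ilog_sum_lshift:
  "has_ilog_sum (\<lambda>k. (m ^ k / fact k) *\<^sub>L (lderiv ^^ k) p) UNIV (lshift m p)"
proof -
  obtain N where "xdeg_le p N" using xdeg_le_exists by blast
  then show ?thesis unfolding lshift_def
    by (intro has_ilog_sum_ilog_sum ilog_summable_decreasing_xdeg[where N = N] xdeg_le_lscale
        xdeg_le_funpow_lderiv)
qed

lemma has_ilog_sum_lintegral:
  "has_ilog_sum (\<lambda>k. (m ^ k / fact k) *\<^sub>L (lderiv ^^ (k - 1)) p) {1..} (lintegral m p)"
proof -
  obtain N where N: "xdeg_le p N" using xdeg_le_exists by blast
  have "ilog_summable (\<lambda>k. (m ^ k / fact k) *\<^sub>L (lderiv ^^ (k - 1)) p) {1..}"
  proof (rule ilog_summable_decreasing_xdeg[where N = "N + 1"])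
    fix k :: nat assume "k \<in> {1..}"
    then have *: "N + 1 - int k = N - int (k - 1)" by simp
    show "xdeg_le ((m ^ k / fact k) *\<^sub>L (lderiv ^^ (k - 1)) p) (N + 1 - int k)"
      unfolding * by (intro xdeg_le_lscale xdeg_le_funpow_lderiv N)
  qed
  then show ?thesis unfolding lintegral_def by (rule has_ilog_sum_ilog_sum)
qed

lemma lshift_0: "lshift 0 p = p"
proof -
  have *: "{k. lcoeff ((0 ^ k / fact k) *\<^sub>L (lderiv ^^ k) p) u \<noteq> 0} =
      (if lcoeff p u = 0 then {} else {0 :: nat})" for u
    by (auto simp: power_0_left)
  have "has_ilog_sum (\<lambda>k. (0 ^ k / fact k) *\<^sub>L (lderiv ^^ k) p) UNIV p"
    unfolding has_ilog_sum_def using * by simp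
  then show ?thesis unfolding lshift_def by (rule ilog_sum_eqI)
qed

text \<open>The integral is the increment of any antiderivative.\<close>

lemma lintegral_lderiv: "lintegral m (lderiv P) = lshift m P - P"
proof (rule ilog_sum_eqI[of "\<lambda>k. (m ^ k / fact k) *\<^sub>L (lderiv ^^ (k - 1)) (lderiv P)" "{1..}",
      folded lintegral_def])
  let ?f = "\<lambda>k. (m ^ k / fact k) *\<^sub>L (lderiv ^^ k) P"
  let ?g = "\<lambda>k. (m ^ k / fact k) *\<^sub>L (lderiv ^^ (k - 1)) (lderiv P)"
  have fg: "?g k = ?f k" if "k \<in> {1..}" for k
    using that by (cases k) (auto simp: funpow_Suc_right simp del: funpow.simps)
  show "has_ilog_sum ?g {1..} (lshift m P - P)"
    unfolding has_ilog_sum_def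
  proof
    fix u
    let ?S = "{k \<in> UNIV. lcoeff (?f k) u \<noteq> 0}" and ?R = "{k \<in> {1..}. lcoeff (?g k) u \<noteq> 0}"
    have S: "finite ?S" "lcoeff (lshift m P) u = (\<Sum>k\<in>?S. lcoeff (?f k) u)"
      using has_ilog_sum_lshift[of m P] unfolding has_ilog_sum_def by auto
    have R: "?R = ?S - {0}" using fg by (auto simp del: lcoeff_simps)
    have "(\<Sum>k\<in>?S. lcoeff (?f k) u) = lcoeff P u + (\<Sum>k\<in>?S - {0}. lcoeff (?f k) u)"
    proof (cases "0 \<in> ?S")
      case True
      then show ?thesis using S(1) by (subst sum.remove[of _ 0]) auto
    next
      case False
      then show ?thesis by (subst Diff_insert0) auto
    qed
    moreover have "(\<Sum>k\<in>?R. lcoeff (?g k) u) = (\<Sum>k\<in>?S - {0}. lcoeff (?f k) u)"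
      unfolding R by (rule sum.cong[OF refl], subst fg) auto
    ultimately show "finite ?R \<and> lcoeff (lshift m P - P) u = (\<Sum>k\<in>?R. lcoeff (?g k) u)"
      using S R by auto
  qed
qed


section \<open>Bernoulli numbers\<close>

text \<open>
  The operator \<open>J = (e\<^sup>D - 1) / D\<close> on polynomials is the sum of \<open>D\<^sup>k / (k + 1)!\<close> over all \<open>k\<close>; the terms with
  \<open>k\<close> above the degree vanish.
\<close>

definition J_op :: "complex poly \<Rightarrow> complex poly" where
  "J_op p = (\<Sum>k\<le>degree p. smult (1 / fact (Suc k)) ((pderiv ^^ k) p))"

definition bernoulli_poly :: "nat \<Rightarrow> complex poly" where
  "bernoulli_poly k = inv J_op (monom 1 k)"

definition bernoulli :: "nat \<Rightarrow> complex" where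
  "bernoulli k = poly (bernoulli_poly k) 0"

definition fps_op :: "complex fps \<Rightarrow> complex poly \<Rightarrow> complex poly" where
  "fps_op f p = (\<Sum>k\<le>degree p. smult (fps_nth f k) ((pderiv ^^ k) p))"

lemma higher_pderiv_eq_0: "degree (p :: complex poly) < k \<Longrightarrow> (pderiv ^^ k) p = 0"
  by (intro poly_eqI) (simp add: coeff_higher_pderiv coeff_eq_0)

lemma fps_op_bound:
  assumes "degree p \<le> N"
  shows "fps_op f p = (\<Sum>k\<le>N. smult (fps_nth f k) ((pderiv ^^ k) p))"
  unfolding fps_op_def using assms
  by (intro sum.mono_neutral_left) (auto simp: higher_pderiv_eq_0)

lemma degree_fps_op: "degree (fps_op f p) \<le> degree p"
  unfolding fps_op_def
proof (intro degree_sum_le)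
  fix k
  show "degree (smult (fps_nth f k) ((pderiv ^^ k) p)) \<le> degree p"
    by (rule order_trans[OF degree_smult_le]) (simp add: degree_higher_pderiv)
qed simp

lemma smult_sum_right: "smult c (\<Sum>i\<in>A. f i) = (\<Sum>i\<in>A. smult c (f i))"
  by (induction A rule: infinite_finite_induct) (auto simp: smult_add_right)

lemma fps_op_mult: "fps_op f (fps_op g p) = fps_op (f * g) p"
proof -
  define N where "N = degree p"
  have t: "(pderiv ^^ i) ((pderiv ^^ j) p) = (pderiv ^^ (i + j)) p" for i j
    by (simp add: funpow_add)
  let ?h = "\<lambda>i j. smult (fps_nth f i * fps_nth g j) ((pderiv ^^ (i + j)) p)"
  have "fps_op f (fps_op g p) = (\<Sum>i\<le>N. smult (fps_nth f i) ((pderiv ^^ i) (fps_op g p)))"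
    by (rule fps_op_bound) (simp add: N_def degree_fps_op)
  also have "\<dots> = (\<Sum>i\<le>N. \<Sum>j\<le>N. ?h i j)"
    by (simp add: fps_op_bound[of p N g] N_def higher_pderiv_sum higher_pderiv_smult smult_sum_right t)
  also have "\<dots> = (\<Sum>(i, j)\<in>{..N} \<times> {..N}. ?h i j)"
    by (simp add: sum.cartesian_product)
  also have "\<dots> = (\<Sum>(i, j)\<in>{(i, j). i + j \<le> N}. ?h i j)"
    by (rule sum.mono_neutral_right) (auto simp: N_def, meson higher_pderiv_eq_0 not_le)
  also have "\<dots> = (\<Sum>n\<le>N. \<Sum>i\<le>n. ?h i (n - i))"
    by (rule sum.triangle_reindex_eq)
  also have "\<dots> = fps_op (f * g) p"
    by (simp add: fps_op_def N_def fps_mult_nth smult_sum atLeast0AtMost)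
  finally show ?thesis .
qed

lemma fps_op_1: "fps_op 1 p = p"
proof -
  have "fps_op 1 p = (\<Sum>k\<le>degree p. if k = 0 then p else 0)"
    unfolding fps_op_def by (intro sum.cong) auto
  then show ?thesis by simp
qed

definition J_fps :: "complex fps" where
  "J_fps = Abs_fps (\<lambda>k. 1 / fact (Suc k))"

lemma J_op_eq_fps_op: "J_op = fps_op J_fps"
  by (simp add: fun_eq_iff J_op_def fps_op_def J_fps_def)

lemma J_fps_inverse: "J_fps * inverse J_fps = 1" "inverse J_fps * J_fps = 1"
proof -
  have "fps_nth J_fps 0 \<noteq> 0" by (simp add: J_fps_def)
  then show "inverse J_fps * J_fps = 1" by (rule inverse_mult_eq_1)
  then show "J_fps * inverse J_fps = 1" by (simp add: mult.commute)
qed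

lemma bij_J_op: "bij J_op"
  by (rule o_bij[of "fps_op (inverse J_fps)"])
    (simp_all add: fun_eq_iff J_op_eq_fps_op fps_op_mult fps_op_1 J_fps_inverse)

lemma bernoulli_poly_eq: "bernoulli_poly k = fps_op (inverse J_fps) (monom 1 k)"
  unfolding bernoulli_poly_def
  by (rule inv_f_eq[OF bij_is_inj[OF bij_J_op]])
    (simp add: J_op_eq_fps_op fps_op_mult fps_op_1 J_fps_inverse)

lemma bernoulli_eq: "bernoulli k = fact k * fps_nth (inverse J_fps) k"
proof -
  have "poly ((pderiv ^^ j) (monom 1 k)) 0 = (if j = k then fact k else (0::complex))" if "j \<le> k" for j
    using that by (auto simp: poly_0_coeff_0 coeff_higher_pderiv pochhammer_fact)
  then have "(\<Sum>j\<le>k. fps_nth (inverse J_fps) j * poly ((pderiv ^^ j) (monom 1 k)) 0) =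
      (\<Sum>j\<le>k. if j = k then fact k * fps_nth (inverse J_fps) k else 0)"
    by (intro sum.cong) auto
  then have "bernoulli k = (\<Sum>j\<le>k. if j = k then fact k * fps_nth (inverse J_fps) k else 0)"
    by (simp add: bernoulli_def bernoulli_poly_eq fps_op_bound[of _ k] degree_monom_le poly_sum)
  then show ?thesis by simp
qed

lemma bernoulli_generating_function:
  "Abs_fps (\<lambda>k. bernoulli k / fact k) = fps_X / (fps_exp 1 - 1)"
proof -
  have J: "fps_exp 1 - 1 = fps_X * J_fps"
  proof (rule fps_ext)
    fix n show "fps_nth (fps_exp 1 - 1) n = fps_nth (fps_X * J_fps) n"
      by (cases n) (auto simp: J_fps_def algebra_simps)
  qed
  have "Abs_fps (\<lambda>k. bernoulli k / fact k) = inverse J_fps"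
    by (rule fps_ext) (simp add: bernoulli_eq)
  moreover have nz: "fps_exp 1 - (1 :: complex fps) \<noteq> 0" by simp
  moreover have "fps_X = inverse J_fps * (fps_exp 1 - 1)"
    unfolding J using J_fps_inverse by (metis mult.commute mult.left_commute mult.right_neutral)
  ultimately show ?thesis by (metis nonzero_mult_div_cancel_right)
qed

end

(* The operators f(D) = \<Sum>\<^sub>k f\<^sub>k D\<^sup>k, for f a formal power series, form a commutative algebra acting on
   the logarithmic series: D lowers the exponent of x by one, so every coefficient of f(D) p is a
   finite sum. Put m = n + 1, b = \<Sum>\<^sub>k B\<^sub>k X\<^sup>k / k! and e\<^sup>m\<^sup>X - 1 = X g. The integral from x to x + m
   is q = g(D) p, and the k-th term on the right is b\<^sub>k D\<^sup>k q, so the right-hand side is (b g)(D) p.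
   The left-hand side is (\<Sum>\<^sub>i\<^sub>\<le>\<^sub>n e\<^sup>i\<^sup>X)(D) p, and b g = \<Sum>\<^sub>i\<^sub>\<le>\<^sub>n e\<^sup>i\<^sup>X is a geometric sum. No antiderivative
   of p in the algebra is needed. *)
theory Submission
  imports Defs
begin

section \<open>Manipulating coefficientwise infinite sums\<close>

lemma has_ilog_sum_reindex:
  assumes "bij_betw h A B"
  shows "has_ilog_sum (\<lambda>i. f (h i)) A s \<longleftrightarrow> has_ilog_sum f B s"
proof -
  have bij: "bij_betw h {i\<in>A. lcoeff (f (h i)) u \<noteq> 0} {i\<in>B. lcoeff (f i) u \<noteq> 0}" for u
    using assms unfolding bij_betw_def inj_on_def by auto
  show ?thesis
    unfolding has_ilog_sum_def
    using bij_betw_finite[OF bij] sum.reindex_bij_betw[OF bij, of "\<lambda>i. lcoeff (f i) u" u for u]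
    by simp
qed

lemma has_ilog_sum_cong:
  assumes "\<And>i. i \<in> A \<Longrightarrow> f i = g i"
  shows "has_ilog_sum f A s \<longleftrightarrow> has_ilog_sum g A s"
proof -
  have "{i\<in>A. lcoeff (f i) u \<noteq> 0} = {i\<in>A. lcoeff (g i) u \<noteq> 0}" for u
    using assms by auto
  then show ?thesis
    unfolding has_ilog_sum_def using assms by simp
qed

text \<open>Frees the index set from the exact support: several sums can then be expanded over one
  common finite set and compared term by term.\<close>

lemma lcoeff_has_ilog_sum:
  assumes "has_ilog_sum f A s" "finite S" "S \<subseteq> A" "\<And>i. i \<in> A \<Longrightarrow> lcoeff (f i) u \<noteq> 0 \<Longrightarrow> i \<in> S"
  shows "lcoeff s u = (\<Sum>i\<in>S. lcoeff (f i) u)"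
proof -
  have "lcoeff s u = (\<Sum>i | i \<in> A \<and> lcoeff (f i) u \<noteq> 0. lcoeff (f i) u)"
    using assms(1) unfolding has_ilog_sum_def by blast
  also have "\<dots> = (\<Sum>i\<in>S. lcoeff (f i) u)"
    using assms(2-4) by (intro sum.mono_neutral_left) auto
  finally show ?thesis .
qed

lemma has_ilog_sum_remove:
  assumes s: "has_ilog_sum f A s" and a: "a \<in> A"
  shows "has_ilog_sum f (A - {a}) (s - f a)"
  unfolding has_ilog_sum_def
proof
  fix u
  let ?S = "{i\<in>A. lcoeff (f i) u \<noteq> 0}"
  let ?R = "{i \<in> A - {a}. lcoeff (f i) u \<noteq> 0}"
  have fin: "finite ?S" using s unfolding has_ilog_sum_def by blast
  have R: "finite ?R" by (rule finite_subset[OF _ fin]) auto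
  \<comment> \<open>Inserting \<open>a\<close> unconditionally avoids a case split on whether
    \<open>f a\<close> contributes at \<open>u\<close>.\<close>
  have "lcoeff s u = (\<Sum>i\<in>insert a ?R. lcoeff (f i) u)"
    by (rule lcoeff_has_ilog_sum[OF s]) (use R a in auto)
  then show "finite ?R \<and> lcoeff (s - f a) u = (\<Sum>i\<in>?R. lcoeff (f i) u)"
    using R by simp
qed

section \<open>Linearity of the derivative and its powers\<close>

lemma lderiv_add: "lderiv (p + q) = lderiv p + lderiv q"
proof (rule ilog_eqI)
  fix v
  define S where
    "S r = {u. lcoeff (lcoeff r u *\<^sub>L lderiv_monom u) v \<noteq> 0}" for r
  have fin: "finite (S r)" for r
    using has_ilog_sum_lderiv[of r] by (simp add: has_ilog_sum_def S_def)
  \<comment> \<open>The contributing monomials of \<open>p\<close>, \<open>q\<close> and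
    \<open>p + q\<close> may differ, so all three derivatives are expanded over
    \<open>S p \<union> S q\<close>.\<close>
  have eq: "lcoeff (lderiv r) v =
      (\<Sum>u\<in>S p \<union> S q. lcoeff r u * lcoeff (lderiv_monom u) v)" if "S r \<subseteq> S p \<union> S q" for r
  proof -
    have "lcoeff (lderiv r) v =
        (\<Sum>u\<in>S p \<union> S q. lcoeff (lcoeff r u *\<^sub>L lderiv_monom u) v)"
      by (rule lcoeff_has_ilog_sum[OF has_ilog_sum_lderiv]) (use that fin S_def in auto)
    then show ?thesis by simp
  qed
  have "S (p + q) \<subseteq> S p \<union> S q" by (auto simp: S_def)
  then show "lcoeff (lderiv (p + q)) v = lcoeff (lderiv p + lderiv q) v"
    by (simp add: eq sum.distrib algebra_simps)
qed

lemma lderiv_scale: "lderiv (c *\<^sub>L p) = c *\<^sub>L lderiv p"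
proof (rule ilog_eqI)
  fix v
  define S where "S = {u. lcoeff (lcoeff p u *\<^sub>L lderiv_monom u) v \<noteq> 0}"
  have fin: "finite S"
    using has_ilog_sum_lderiv[of p] by (simp add: has_ilog_sum_def S_def)
  have "lcoeff (lderiv p) v = (\<Sum>u\<in>S. lcoeff (lcoeff p u *\<^sub>L lderiv_monom u) v)"
    by (rule lcoeff_has_ilog_sum[OF has_ilog_sum_lderiv]) (use fin S_def in auto)
  moreover have "lcoeff (lderiv (c *\<^sub>L p)) v =
      (\<Sum>u\<in>S. lcoeff (lcoeff (c *\<^sub>L p) u *\<^sub>L lderiv_monom u) v)"
    by (rule lcoeff_has_ilog_sum[OF has_ilog_sum_lderiv]) (use fin S_def in auto)
  ultimately show "lcoeff (lderiv (c *\<^sub>L p)) v = lcoeff (c *\<^sub>L lderiv p) v"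
    by (simp add: sum_distrib_left mult.assoc)
qed

lemma funpow_lderiv_add: "(lderiv ^^ k) (p + q) = (lderiv ^^ k) p + (lderiv ^^ k) q"
  by (induction k) (simp_all add: lderiv_add)

lemma funpow_lderiv_scale: "(lderiv ^^ k) (c *\<^sub>L p) = c *\<^sub>L (lderiv ^^ k) p"
  by (induction k) (simp_all add: lderiv_scale)

lemma funpow_lderiv_sum: "(lderiv ^^ k) (\<Sum>i\<in>A. f i) = (\<Sum>i\<in>A. (lderiv ^^ k) (f i))"
proof -
  have "(lderiv ^^ k) 0 = 0"
    using funpow_lderiv_add[of k 0 0] by simp
  then show ?thesis
    by (induction A rule: infinite_finite_induct) (simp_all add: funpow_lderiv_add)
qed

section \<open>Power series in the derivative acting on logarithmic series\<close>

definition fps_lderiv :: "complex fps \<Rightarrow> ilog \<Rightarrow> ilog" where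
  "fps_lderiv f p = ilog_sum (\<lambda>k. fps_nth f k *\<^sub>L (lderiv ^^ k) p) UNIV"

lemma has_ilog_sum_fps_lderiv:
  "has_ilog_sum (\<lambda>k. fps_nth f k *\<^sub>L (lderiv ^^ k) p) UNIV (fps_lderiv f p)"
proof -
  obtain N where "xdeg_le p N" using xdeg_le_exists by blast
  then show ?thesis unfolding fps_lderiv_def
    by (intro has_ilog_sum_ilog_sum ilog_summable_decreasing_xdeg[where N = N] xdeg_le_lscale
        xdeg_le_funpow_lderiv)
qed

lemma lcoeff_eq_0_if_xdeg_le: "xdeg_le p N \<Longrightarrow> N < Poly_Mapping.lookup u 0 \<Longrightarrow> lcoeff p u = 0"
  unfolding xdeg_le_def by force

text \<open>Since \<open>D^k p\<close> has \<open>x\<close>-degree at most \<open>N - k\<close>,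
  terms with \<open>k > K\<close> cannot reach \<open>u\<close>. The cutoff \<open>K\<close> does
  not depend on \<open>f\<close>, so identities between operators reduce to finite sums over a
  common range.\<close>

lemma lcoeff_fps_lderiv:
  assumes "xdeg_le p N" "N - Poly_Mapping.lookup u 0 \<le> int K"
  shows "lcoeff (fps_lderiv f p) u = (\<Sum>k\<le>K. fps_nth f k * lcoeff ((lderiv ^^ k) p) u)"
proof -
  have "lcoeff (fps_lderiv f p) u = (\<Sum>k\<le>K. lcoeff (fps_nth f k *\<^sub>L (lderiv ^^ k) p) u)"
  proof (rule lcoeff_has_ilog_sum[OF has_ilog_sum_fps_lderiv])
    fix k assume "lcoeff (fps_nth f k *\<^sub>L (lderiv ^^ k) p) u \<noteq> 0"
    then have "Poly_Mapping.lookup u 0 \<le> N - int k"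
      using xdeg_le_lscale[OF xdeg_le_funpow_lderiv[OF assms(1)]] unfolding xdeg_le_def by blast
    then show "k \<in> {..K}" using assms(2) by simp
  qed auto
  then show ?thesis by simp
qed

lemma fps_lderiv_sum: "fps_lderiv (\<Sum>i\<in>A. f i) p = (\<Sum>i\<in>A. fps_lderiv (f i) p)"
proof (rule ilog_eqI)
  fix u :: lmonom
  obtain N where N: "xdeg_le p N" using xdeg_le_exists by blast
  define K where "K = nat (N - Poly_Mapping.lookup u 0)"
  have K: "N - Poly_Mapping.lookup u 0 \<le> int K" by (simp add: K_def)
  have "lcoeff (fps_lderiv (\<Sum>i\<in>A. f i) p) u
      = (\<Sum>k\<le>K. \<Sum>i\<in>A. fps_nth (f i) k * lcoeff ((lderiv ^^ k) p) u)"
    by (simp add: lcoeff_fps_lderiv[OF N K] fps_sum_nth sum_distrib_right)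
  also have "\<dots> = (\<Sum>i\<in>A. \<Sum>k\<le>K. fps_nth (f i) k * lcoeff ((lderiv ^^ k) p) u)"
    by (rule sum.swap)
  finally show "lcoeff (fps_lderiv (\<Sum>i\<in>A. f i) p) u = lcoeff (\<Sum>i\<in>A. fps_lderiv (f i) p) u"
    by (simp add: lcoeff_fps_lderiv[OF N K])
qed

lemma fps_lderiv_diff: "fps_lderiv (f - g) p = fps_lderiv f p - fps_lderiv g p"
proof (rule ilog_eqI)
  fix u :: lmonom
  obtain N where N: "xdeg_le p N" using xdeg_le_exists by blast
  define K where "K = nat (N - Poly_Mapping.lookup u 0)"
  have K: "N - Poly_Mapping.lookup u 0 \<le> int K" by (simp add: K_def)
  show "lcoeff (fps_lderiv (f - g) p) u = lcoeff (fps_lderiv f p - fps_lderiv g p) u"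
    by (simp add: lcoeff_fps_lderiv[OF N K] algebra_simps sum_subtractf)
qed

text \<open>Lets derivatives of \<open>p\<close> enter the calculus of power series, so that they
  can be multiplied with other operators.\<close>

lemma fps_lderiv_X_power: "fps_lderiv (fps_X ^ k) p = (lderiv ^^ k) p"
proof (rule ilog_eqI)
  fix u
  have "lcoeff (fps_lderiv (fps_X ^ k) p) u
      = (\<Sum>j\<in>{k}. lcoeff (fps_nth (fps_X ^ k) j *\<^sub>L (lderiv ^^ j) p) u)"
    by (rule lcoeff_has_ilog_sum[OF has_ilog_sum_fps_lderiv]) (auto split: if_splits)
  then show "lcoeff (fps_lderiv (fps_X ^ k) p) u = lcoeff ((lderiv ^^ k) p) u" by simp
qed

lemma fps_lderiv_1: "fps_lderiv 1 p = p"
  using fps_lderiv_X_power[of 0 p] by simp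

lemma xdeg_le_fps_lderiv: "xdeg_le p N \<Longrightarrow> xdeg_le (fps_lderiv f p) N"
  unfolding xdeg_le_def[of "fps_lderiv f p"]
proof (intro allI impI)
  fix u assume p: "xdeg_le p N" and nz: "lcoeff (fps_lderiv f p) u \<noteq> 0"
  show "Poly_Mapping.lookup u 0 \<le> N"
  proof (rule ccontr)
    assume "\<not> ?thesis"
    \<comment> \<open>With cutoff 0 only the term \<open>k = 0\<close> survives, and it is a
      multiple of \<open>lcoeff p u\<close>, which vanishes.\<close>
    then have u: "N - Poly_Mapping.lookup u 0 \<le> int 0" "N < Poly_Mapping.lookup u 0" by auto
    show False
      using nz lcoeff_fps_lderiv[OF p u(1)] lcoeff_eq_0_if_xdeg_le[OF p u(2)] by simp
  qed
qed

text \<open>This is how \<open>D^i\<close> passes through the infinite sum: linearity handles the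
  truncation \<open>T\<close>, while the remainder \<open>R\<close> has \<open>x\<close>-degree too
  low to reach \<open>u\<close>, and \<open>D^i\<close> only lowers it further.\<close>

lemma lcoeff_funpow_lderiv_fps_lderiv:
  assumes p: "xdeg_le p N" and K: "N - Poly_Mapping.lookup u 0 \<le> int K"
  shows "lcoeff ((lderiv ^^ i) (fps_lderiv f p)) u
    = (\<Sum>j\<le>K. fps_nth f j * lcoeff ((lderiv ^^ (i + j)) p) u)"
proof -
  define T where "T = (\<Sum>j\<le>K. fps_nth f j *\<^sub>L (lderiv ^^ j) p)"
  define R where "R = fps_lderiv f p - T"
  have "xdeg_le R (N - int K - 1)"
    unfolding xdeg_le_def
  proof (intro allI impI, rule ccontr)
    fix v assume nz: "lcoeff R v \<noteq> 0" and "\<not> Poly_Mapping.lookup v 0 \<le> N - int K - 1"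
    then have "N - Poly_Mapping.lookup v 0 \<le> int K" by simp
    from lcoeff_fps_lderiv[OF p this, of f] nz show False
      by (simp add: R_def T_def)
  qed
  then have "xdeg_le ((lderiv ^^ i) R) (N - int K - 1 - int i)"
    by (rule xdeg_le_funpow_lderiv)
  then have "lcoeff ((lderiv ^^ i) R) u = 0"
    by (rule lcoeff_eq_0_if_xdeg_le) (use K in simp)
  moreover have "fps_lderiv f p = T + R" by (simp add: R_def)
  ultimately have "lcoeff ((lderiv ^^ i) (fps_lderiv f p)) u = lcoeff ((lderiv ^^ i) T) u"
    by (simp add: funpow_lderiv_add)
  then show ?thesis
    by (simp add: T_def funpow_lderiv_sum funpow_lderiv_scale funpow_add)
qed

lemma fps_lderiv_mult: "fps_lderiv f (fps_lderiv g p) = fps_lderiv (f * g) p"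
proof (rule ilog_eqI)
  fix u :: lmonom
  obtain N where N: "xdeg_le p N" using xdeg_le_exists by blast
  define K where "K = nat (N - Poly_Mapping.lookup u 0)"
  have K: "N - Poly_Mapping.lookup u 0 \<le> int K" by (simp add: K_def)
  let ?c = "\<lambda>k. lcoeff ((lderiv ^^ k) p) u"
  \<comment> \<open>This cuts the square of index pairs down to the triangle
    \<open>i + j \<le> K\<close>, whose antidiagonals are the coefficients of the Cauchy
    product.\<close>
  have zero: "?c k = 0" if "K < k" for k
    by (rule lcoeff_eq_0_if_xdeg_le[OF xdeg_le_funpow_lderiv[OF N, of k]]) (use K that in linarith)
  let ?h = "\<lambda>i j. fps_nth f i * fps_nth g j * ?c (i + j)"
  have "lcoeff (fps_lderiv f (fps_lderiv g p)) u = (\<Sum>i\<le>K. \<Sum>j\<le>K. ?h i j)"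
    by (simp add: lcoeff_fps_lderiv[OF xdeg_le_fps_lderiv[OF N] K]
        lcoeff_funpow_lderiv_fps_lderiv[OF N K] sum_distrib_left mult.assoc)
  also have "\<dots> = (\<Sum>(i, j)\<in>{..K} \<times> {..K}. ?h i j)"
    by (simp add: sum.cartesian_product)
  also have "\<dots> = (\<Sum>(i, j)\<in>{(i, j). i + j \<le> K}. ?h i j)"
    by (rule sum.mono_neutral_right) (auto, meson zero not_le)
  also have "\<dots> = (\<Sum>n\<le>K. \<Sum>i\<le>n. ?h i (n - i))"
    by (rule sum.triangle_reindex_eq)
  also have "\<dots> = lcoeff (fps_lderiv (f * g) p) u"
    by (simp add: lcoeff_fps_lderiv[OF N K] fps_mult_nth sum_distrib_right atLeast0AtMost)
  finally show "lcoeff (fps_lderiv f (fps_lderiv g p)) u = lcoeff (fps_lderiv (f * g) p) u" .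
qed

section \<open>Shift, integral and Bernoulli series as elements of the operator calculus\<close>

lemma lshift_eq_fps_lderiv: "lshift m p = fps_lderiv (fps_exp m) p"
  by (simp add: lshift_def fps_lderiv_def)

text \<open>The integral is the operator \<open>(e^(mD) - 1) / D\<close>; reindexing by
  \<open>Suc\<close> turns its sum from 1 into a series with coefficients
  \<open>m^(k+1) / (k+1)!\<close>.\<close>

lemma lintegral_eq_fps_lderiv: "lintegral m p = fps_lderiv (fps_shift 1 (fps_exp m - 1)) p"
proof -
  let ?f = "\<lambda>k. (m ^ k / fact k) *\<^sub>L (lderiv ^^ (k - 1)) p"
  have "bij_betw Suc UNIV {1..}"
    by (auto simp: bij_betw_def image_iff) (metis Suc_le_D)
  then have "has_ilog_sum (\<lambda>k. ?f (Suc k)) UNIV (lintegral m p)"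
    using has_ilog_sum_lintegral by (subst has_ilog_sum_reindex) auto
  moreover have "has_ilog_sum (\<lambda>k. ?f (Suc k)) UNIV (fps_lderiv (fps_shift 1 (fps_exp m - 1)) p)"
    using has_ilog_sum_fps_lderiv[of "fps_shift 1 (fps_exp m - 1)" p]
    by (simp add: algebra_simps)
  ultimately show ?thesis by (rule has_ilog_sum_unique)
qed

text \<open>The factors are \<open>X / (e^X - 1)\<close> and \<open>(e^(mX) - 1) / X\<close> with
  \<open>m = n + 1\<close>; their product is the closed form of a geometric sum with ratio
  \<open>e^X\<close>.\<close>

lemma bernoulli_fps_mult_integral_fps:
  "Abs_fps (\<lambda>k. bernoulli k / fact k) * fps_shift 1 (fps_exp (of_nat (Suc n)) - 1)
    = (\<Sum>i\<le>n. fps_exp (of_nat i :: complex))"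
    (is "?b * ?g = ?s")
proof -
  let ?e = "fps_exp 1 :: complex fps"
  have nz: "?e - 1 \<noteq> 0" by simp
  \<comment> \<open>The vanishing constant term makes \<open>fps_shift 1\<close> an exact division
    by \<open>X\<close>.\<close>
  have "fps_nth (fps_exp (of_nat (Suc n)) - 1 :: complex fps) 0 = 0" by simp
  then have g: "?g * fps_X = fps_exp (of_nat (Suc n)) - 1"
    by (intro fps_ext) auto
  have b: "?b * (?e - 1) = fps_X"
  proof -
    have "?e - 1 = fps_X * J_fps"
      by (rule fps_ext, rename_tac k, case_tac k) (auto simp: J_fps_def algebra_simps)
    moreover have "?b = inverse J_fps"
      by (rule fps_ext) (simp add: bernoulli_eq)
    ultimately show ?thesis
      using J_fps_inverse(2) by (simp add: mult.left_commute)
  qed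
  have "?s = (\<Sum>i<Suc n. ?e ^ i)"
    by (simp add: fps_exp_power_mult lessThan_Suc_atMost)
  \<comment> \<open>Both sides of the claim are compared after multiplication by
    \<open>?e - 1\<close>, a nonzero element of an integral domain, which is cancelled at the
    end.\<close>
  then have "(?e - 1) * ?s = ?e ^ Suc n - 1"
    by (simp only: power_diff_1_eq)
  also have "\<dots> = ?g * (?b * (?e - 1))"
    by (simp only: g b fps_exp_power_mult mult_1_right)
  finally have "(?e - 1) * ?s = (?e - 1) * (?b * ?g)"
    by (simp only: mult_ac)
  then show ?thesis using nz by simp
qed

theorem mainTheorem6:
  fixes p :: ilog and n :: nat
  shows
    "ilog_summable
       (\<lambda>k. (bernoulli k / fact k) *\<^sub>L
          (lshift (of_nat (n + 1)) ((lderiv ^^ (k - 1)) p) - (lderiv ^^ (k - 1)) p)) {1..} \<and>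
     (\<Sum>i\<le>n. lshift (of_nat i) p) =
       bernoulli 0 *\<^sub>L lintegral (of_nat (n + 1)) p +
       ilog_sum
         (\<lambda>k. (bernoulli k / fact k) *\<^sub>L
            (lshift (of_nat (n + 1)) ((lderiv ^^ (k - 1)) p) - (lderiv ^^ (k - 1)) p)) {1..}"
proof -
  let ?m = "of_nat (n + 1) :: complex"
  let ?t = "\<lambda>k. (bernoulli k / fact k) *\<^sub>L
    (lshift ?m ((lderiv ^^ (k - 1)) p) - (lderiv ^^ (k - 1)) p)"
  define b where "b = Abs_fps (\<lambda>k. bernoulli k / fact k)"
  define g where "g = fps_shift 1 (fps_exp ?m - 1)"
  define q where "q = fps_lderiv g p"
  have X: "fps_exp ?m - 1 = g * fps_X"
    unfolding g_def by (intro fps_ext) auto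
  \<comment> \<open>The factor \<open>X\<close> of \<open>e^(mX) - 1 = g X\<close> raises
    \<open>X^(k-1)\<close> to \<open>X^k\<close>. This needs \<open>k \<ge> 1\<close>, as
    \<open>k - 1\<close> is truncated at 0.\<close>
  have term_eq: "?t k = fps_nth b k *\<^sub>L (lderiv ^^ k) q" if "k \<in> {1..}" for k
  proof -
    have k: "fps_X * fps_X ^ (k - 1) = (fps_X ^ k :: complex fps)"
      using that by (cases k) auto
    have "lshift ?m ((lderiv ^^ (k - 1)) p) - (lderiv ^^ (k - 1)) p
        = fps_lderiv (fps_exp ?m - 1) (fps_lderiv (fps_X ^ (k - 1)) p)"
      by (simp only: lshift_eq_fps_lderiv fps_lderiv_diff fps_lderiv_1 fps_lderiv_X_power)
    also have "\<dots> = fps_lderiv (fps_X ^ k * g) p"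
      unfolding fps_lderiv_mult X mult.assoc k by (simp only: mult.commute)
    also have "\<dots> = (lderiv ^^ k) q"
      by (simp only: q_def fps_lderiv_mult[symmetric] fps_lderiv_X_power)
    finally show ?thesis by (simp add: b_def)
  qed
  \<comment> \<open>The term \<open>k = 0\<close> of \<open>b(D) q\<close> is
    \<open>bernoulli 0 *\<^sub>L q\<close>, the integral term of the formula; the remaining terms
    form the sum over \<open>k \<ge> 1\<close>.\<close>
  have "has_ilog_sum (\<lambda>k. fps_nth b k *\<^sub>L (lderiv ^^ k) q) (UNIV - {0})
      (fps_lderiv b q - fps_nth b 0 *\<^sub>L (lderiv ^^ 0) q)"
    by (rule has_ilog_sum_remove[OF has_ilog_sum_fps_lderiv]) simp
  moreover have "UNIV - {0} = {1 :: nat..}" by auto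
  ultimately have "has_ilog_sum ?t {1..} (fps_lderiv b q - bernoulli 0 *\<^sub>L q)"
    using has_ilog_sum_cong[of "{1..}" ?t, OF term_eq] by (simp add: b_def)
  moreover have "fps_lderiv b q = (\<Sum>i\<le>n. lshift (of_nat i) p)"
    using bernoulli_fps_mult_integral_fps[of n]
    by (simp add: q_def b_def g_def fps_lderiv_mult lshift_eq_fps_lderiv flip: fps_lderiv_sum)
  moreover have "lintegral ?m p = q"
    by (simp only: lintegral_eq_fps_lderiv q_def g_def)
  ultimately have sum: "has_ilog_sum ?t {1..}
      ((\<Sum>i\<le>n. lshift (of_nat i) p) - bernoulli 0 *\<^sub>L lintegral ?m p)"
    by simp
  then have "ilog_summable ?t {1..}"
    unfolding ilog_summable_def by blast
  then show ?thesis
    unfolding ilog_sum_eqI[OF sum] by simp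
qed

end
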